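(* Let $\mathcal{A}:\mathbb{R}^n\rightrightarrows\mathbb{R}^n$ be a set-valued mapping whose solution set $S:=\mathcal{A}^{-1}(0)=\{x : 0\in\mathcal{A}(x)\}$ is nonempty, and let $(x_k)_{k\ge0}$ be a sequence of iterates in $\mathbb{R}^n$ generated by an algorithm of R-class for $\mathcal{A}$. Then: (i) If $\mathcal{A}^{-1}$ is R-continuous at $0$, then $\mathbf{d}(x_k,S)\to0$ as $k\to\infty$. (ii) If the sequence $(x_k)$ is bounded and $\mathcal{A}^{-1}$ is compactly R-continuous at $0$, then $\mathbf{d}(x_k,S)\to0$ as $k\to\infty$.
   Context: $\mathcal{A}^{-1}(y)=\{x : y\in\mathcal{A}(x)\}$; $\mathbf{d}(x,\Omega)=\inf_{y\in\Omega}\|x-y\|$; $\mathbb{B}$ is the closed unit ball and $\mathbb{B}(\bar x,\sigma)$ the closed ball with center $\bar x$ and radius $\sigma$. R-class: an algorithm generating $(x_k)$ is of R-class for $\mathcal{A}$ if there exist a function $\xi:\mathbb{N}\to[0,\infty)$ with $\xi(k)\to0$ as $k\to\infty$ and constants $\alpha,\beta>0$ such that for each $k=0,1,\ldots$ there exists $w_k\in\mathcal{A}(x_k)$ with $\|w_k\|\le\alpha\,\xi(k)^{\beta}$. R-continuity: a set-valued mapping $\mathcal{B}:\mathbb{R}^n\rightrightarrows\mathbb{R}^n$ is R-continuous at $\bar x$ (with $\mathcal{B}(\bar x)\neq\emptyset$) if there exist $\sigma>0$ and a nondecreasing $\rho:[0,\infty)\to[0,\infty)$ with $\lim_{r\to0^+}\rho(r)=\rho(0)=0$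 such that $\mathcal{B}(x)\subset\mathcal{B}(\bar x)+\rho(\|x-\bar x\|)\mathbb{B}$ for all $x\in\mathbb{B}(\bar x,\sigma)$. Compact R-continuity: $\mathcal{B}$ is compactly R-continuous at $\bar x$ if for every compact set $K\subset\mathbb{R}^n$ there exist $\sigma>0$ and a nondecreasing $\rho:[0,\infty)\to[0,\infty)$ with $\lim_{r\to0^+}\rho(r)=\rho(0)=0$ such that $\mathcal{B}(x)\cap K\subset\mathcal{B}(\bar x)+\rho(\|x-\bar x\|)\mathbb{B}$ for all $x\in\mathbb{B}(\bar x,\sigma)$. *)

theory Defs
  imports "HOL-Analysis.Analysis" "HOL-Library.Set_Algebras"
begin

text \<open>A set-valued mapping is a function into sets; its value may be empty.\<close>

definition inverse_mapping :: "('a \<Rightarrow> 'b set) \<Rightarrow> 'b \<Rightarrow> 'a set" where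
  "inverse_mapping A y = {x. y \<in> A x}"

text \<open>
  Functions on \<open>[0, \<infinity>)\<close> are represented by total functions on the reals that are constrained
  only on \<open>{0..}\<close>; the value at negative arguments is irrelevant.
\<close>

definition modulus_function :: "(real \<Rightarrow> real) \<Rightarrow> bool" where
  "modulus_function \<rho> \<longleftrightarrow>
     (\<forall>r\<ge>0. 0 \<le> \<rho> r) \<and> mono_on {0..} \<rho> \<and> (\<rho> \<longlongrightarrow> 0) (at_right 0) \<and> \<rho> 0 = 0"

text \<open>In the next two definitions, \<open>+\<close> between sets is the Minkowski sum.\<close>

definition R_continuous_at ::
    "('a::real_normed_vector \<Rightarrow> 'b::real_normed_vector set) \<Rightarrow> 'a \<Rightarrow> bool" where
  "R_continuous_at B a \<longleftrightarrow>
     B a \<noteq> {} \<and>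
     (\<exists>\<sigma>>0. \<exists>\<rho>. modulus_function \<rho> \<and>
        (\<forall>x\<in>cball a \<sigma>. B x \<subseteq> B a + (*\<^sub>R) (\<rho> (norm (x - a))) ` cball 0 1))"

definition compactly_R_continuous_at ::
    "('a::real_normed_vector \<Rightarrow> 'b::real_normed_vector set) \<Rightarrow> 'a \<Rightarrow> bool" where
  "compactly_R_continuous_at B a \<longleftrightarrow>
     (\<forall>K. compact K \<longrightarrow>
        (\<exists>\<sigma>>0. \<exists>\<rho>. modulus_function \<rho> \<and>
           (\<forall>x\<in>cball a \<sigma>. B x \<inter> K \<subseteq> B a + (*\<^sub>R) (\<rho> (norm (x - a))) ` cball 0 1)))"

text \<open>
  The R-class property of an algorithm depends only on the sequence of iterates it generates, so it
  is a predicate on sequences. Since \<open>0 powr \<beta> = 0\<close>, the real power has its usual meaning also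
  when \<open>\<xi> k = 0\<close>.
\<close>

definition R_class ::
    "('a \<Rightarrow> 'b::real_normed_vector set) \<Rightarrow> (nat \<Rightarrow> 'a) \<Rightarrow> bool" where
  "R_class A x \<longleftrightarrow>
     (\<exists>(\<xi> :: nat \<Rightarrow> real) (\<alpha> :: real) (\<beta> :: real).
        (\<forall>k. 0 \<le> \<xi> k) \<and> \<xi> \<longlonglongrightarrow> 0 \<and> 0 < \<alpha> \<and> 0 < \<beta> \<and>
        (\<forall>k. \<exists>w\<in>A (x k). norm w \<le> \<alpha> * \<xi> k powr \<beta>))"

end

theory Submission
  imports Defs
begin

text \<open>
  The R-class property provides residuals \<open>w k \<in> A (x k)\<close> with \<open>w k \<longlonglongrightarrow> 0\<close>, and \<open>w k \<in> A (x k)\<close>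
  says that \<open>x k\<close> lies in the value of \<open>inverse_mapping A\<close> at \<open>w k\<close>. Both kinds of R-continuity at
  \<open>0\<close> bound the excess of that value, or of its part in a set \<open>K\<close>, over \<open>S\<close> by \<open>\<rho> (norm (w k))\<close>,
  so this number dominates the distance from \<open>x k\<close> to \<open>S\<close> for large \<open>k\<close>, and it tends to \<open>0\<close>.
  The lemma \<open>infdist_tendsto_0_of_local_modulus\<close> carries this out for an arbitrary \<open>K\<close>. Part (i) is
  the case \<open>K = UNIV\<close>; for part (ii), \<open>K\<close> is the closure of the set of iterates, which is compact
  because the iterates are bounded in a finite-dimensional space.
\<close>

lemma R_class_residuals:
  assumes "R_class A x"
  obtains w where "\<And>k. w k \<in> A (x k)" and "w \<longlonglongrightarrow> 0"
proof -
  obtain \<xi> \<alpha> \<beta> where \<xi>: "\<And>k. (0::real) \<le> \<xi> k" "\<xi> \<longlonglongrightarrow> 0" and "0 < (\<beta>::real)"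
    and ex: "\<And>k. \<exists>w\<in>A (x k). norm w \<le> \<alpha> * \<xi> k powr \<beta>"
    using assms unfolding R_class_def by blast
  obtain w where w: "\<And>k. w k \<in> A (x k)" "\<And>k. norm (w k) \<le> \<alpha> * \<xi> k powr \<beta>"
    using ex by metis
  have "(\<lambda>k. \<xi> k powr \<beta>) \<longlonglongrightarrow> 0"
    using \<xi> \<open>0 < \<beta>\<close> tendsto_powr'[OF \<xi>(2) tendsto_const, of \<beta>] by simp
  then have "(\<lambda>k. \<alpha> * \<xi> k powr \<beta>) \<longlonglongrightarrow> 0"
    by (rule tendsto_mult_right_zero)
  then have "w \<longlonglongrightarrow> 0"
    by (rule Lim_null_comparison[rotated]) (simp add: w(2))
  with w(1) show thesis by (rule that)
qed

text \<open>
  The one-sided limit in the definition of a modulus ignores the point \<open>0\<close>, which the sequence may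
  hit; the value \<open>\<rho> 0 = 0\<close> makes \<open>\<rho>\<close> continuous at \<open>0\<close> from the right.
\<close>
lemma modulus_function_tendsto_0:
  assumes "modulus_function \<rho>" and "\<And>k. 0 \<le> r k" and "r \<longlonglongrightarrow> 0"
  shows "(\<lambda>k. \<rho> (r k)) \<longlonglongrightarrow> 0"
proof -
  have "continuous (at 0 within {0..}) \<rho>"
    using assms(1) by (simp add: modulus_function_def continuous_within at_within_Ici_at_right)
  then have "(\<lambda>k. \<rho> (r k)) \<longlonglongrightarrow> \<rho> 0"
    by (rule continuous_within_tendsto_compose) (use assms in auto)
  with assms(1) show ?thesis
    by (simp add: modulus_function_def)
qed

lemma infdist_le_of_mem_plus_scaled_ball:
  fixes S :: "'a::real_normed_vector set"
  assumes "z \<in> S + (*\<^sub>R) c ` cball 0 1" and "0 \<le> c"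
  shows "infdist z S \<le> c"
proof -
  obtain s b where "s \<in> S" and b: "norm b \<le> 1" and z: "z = s + c *\<^sub>R b"
    using assms(1) by (auto simp: set_plus_def)
  have "infdist z S \<le> dist z s"
    using \<open>s \<in> S\<close> by (rule infdist_le)
  also have "\<dots> \<le> c"
    using b \<open>0 \<le> c\<close> by (simp add: z dist_norm mult_left_le)
  finally show ?thesis .
qed

text \<open>
  The set \<open>K\<close> lets one argument serve both R-continuity, where it is the whole space, and compact
  R-continuity, where the modulus may depend on it.
\<close>
lemma infdist_tendsto_0_of_local_modulus:
  fixes B :: "'b::real_normed_vector \<Rightarrow> 'a::real_normed_vector set"
  assumes "0 < \<sigma>" and \<rho>: "modulus_function \<rho>"
    and incl: "\<And>y. y \<in> cball 0 \<sigma> \<Longrightarrow> B y \<inter> K \<subseteq> B 0 + (*\<^sub>R) (\<rho> (norm y)) ` cball 0 1"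
    and mem: "\<And>k. x k \<in> B (w k) \<inter> K" and "w \<longlonglongrightarrow> 0"
  shows "(\<lambda>k. infdist (x k) (B 0)) \<longlonglongrightarrow> 0"
proof (rule tendsto_sandwich[OF _ _ tendsto_const])
  have norm0: "(\<lambda>k. norm (w k)) \<longlonglongrightarrow> 0"
    using \<open>w \<longlonglongrightarrow> 0\<close> by (rule tendsto_norm_zero)
  then show "(\<lambda>k. \<rho> (norm (w k))) \<longlonglongrightarrow> 0"
    by (intro modulus_function_tendsto_0[OF \<rho>]) auto
  have "\<forall>\<^sub>F k in sequentially. norm (w k) < \<sigma>"
    using norm0 \<open>0 < \<sigma>\<close> by (rule order_tendstoD(2))
  then show "\<forall>\<^sub>F k in sequentially. infdist (x k) (B 0) \<le> \<rho> (norm (w k))"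
  proof (rule eventually_mono)
    fix k assume "norm (w k) < \<sigma>"
    then have "x k \<in> B 0 + (*\<^sub>R) (\<rho> (norm (w k))) ` cball 0 1"
      using incl[of "w k"] mem[of k] by auto
    then show "infdist (x k) (B 0) \<le> \<rho> (norm (w k))"
      by (rule infdist_le_of_mem_plus_scaled_ball) (use \<rho> in \<open>simp add: modulus_function_def\<close>)
  qed
qed (simp add: infdist_nonneg)

theorem theorem11:
  fixes A :: "real ^ 'n \<Rightarrow> (real ^ 'n) set"
    and x :: "nat \<Rightarrow> real ^ 'n"
    and S :: "(real ^ 'n) set"
  assumes "S = inverse_mapping A 0"
    and "S \<noteq> {}"
    and "R_class A x"
  shows "(R_continuous_at (inverse_mapping A) 0 \<longrightarrow> (\<lambda>k. infdist (x k) S) \<longlonglongrightarrow> 0) \<and>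
         (bounded (range x) \<and> compactly_R_continuous_at (inverse_mapping A) 0 \<longrightarrow>
            (\<lambda>k. infdist (x k) S) \<longlonglongrightarrow> 0)"
proof -
  let ?B = "inverse_mapping A"
  obtain w where "\<And>k. w k \<in> A (x k)" and w: "w \<longlonglongrightarrow> 0"
    using R_class_residuals[OF assms(3)] by blast
  then have mem: "x k \<in> ?B (w k)" for k
    by (simp add: inverse_mapping_def)
  show ?thesis
  proof (intro conjI impI)
    assume "R_continuous_at ?B 0"
    then obtain \<sigma> \<rho> where "0 < \<sigma>" "modulus_function \<rho>"
      and "\<And>y. y \<in> cball 0 \<sigma> \<Longrightarrow> ?B y \<inter> UNIV \<subseteq> ?B 0 + (*\<^sub>R) (\<rho> (norm y)) ` cball 0 1"
      unfolding R_continuous_at_def diff_zero Int_UNIV_right by blast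
    then show "(\<lambda>k. infdist (x k) S) \<longlonglongrightarrow> 0"
      unfolding assms(1)
      by (rule infdist_tendsto_0_of_local_modulus) (use mem w in auto)
  next
    assume ii: "bounded (range x) \<and> compactly_R_continuous_at ?B 0"
    let ?K = "closure (range x)"
    have "compact ?K"
      using ii by (simp add: compact_closure)
    then have "\<exists>\<sigma>>0. \<exists>\<rho>. modulus_function \<rho> \<and>
        (\<forall>y\<in>cball 0 \<sigma>. ?B y \<inter> ?K \<subseteq> ?B 0 + (*\<^sub>R) (\<rho> (norm (y - 0))) ` cball 0 1)"
      using ii unfolding compactly_R_continuous_at_def by blast
    then obtain \<sigma> \<rho> where "0 < \<sigma>" "modulus_function \<rho>"
      and "\<And>y. y \<in> cball 0 \<sigma> \<Longrightarrow> ?B y \<inter> ?K \<subseteq> ?B 0 + (*\<^sub>R) (\<rho> (norm y)) ` cball 0 1"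
      unfolding diff_zero by blast
    moreover have "x k \<in> ?B (w k) \<inter> ?K" for k
      using mem[of k] closure_subset[of "range x"] by auto
    ultimately show "(\<lambda>k. infdist (x k) S) \<longlonglongrightarrow> 0"
      unfolding assms(1) using w by (rule infdist_tendsto_0_of_local_modulus)
  qed
qed

end
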